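(* Let $W$ be one of the unbranched George groups of window size $n$, namely $S_n$, $S^B_n$, $\widetilde{S}_n$, or $\widetilde{S}^C_n$. Then for every $w \in W$, \[ \$(w) = \frac{\operatorname{tvd}(w)}{2}. \]
   Context: Fix a positive integer $n$ and write $[n]=\{1,\dots,n\}$, $\pm[n]=\{\pm1,\dots,\pm n\}$. The groups are: $S_n$, all bijections of $[n]$; $S^B_n$, all bijections $w$ of $\pm[n]$ with $w(-i)=-w(i)$; $\widetilde{S}_n$, all bijections $w:\mathbb{Z}\to\mathbb{Z}$ with $w(i+n)=w(i)+n$ for all $i$ and $w(1)+\cdots+w(n)=\binom{n+1}{2}$; $\widetilde{S}^C_n$, all bijections $w:\mathbb{Z}\to\mathbb{Z}$ with $w(-i)=-w(i)$ and $w(i+2n+2)=w(i)+2n+2$ for all $i$. The total displacement is $\operatorname{tvd}(w)=\sum_{i=1}^n |w(i)-i|$. A pair $\{i,j\}$ of distinct elements of the domain is transposable for $W$ if some $w\in W$ has $w(i)=j$ and $w(j)=i$; for such a pair the transposition $\langle (i~j)\rangle$ is the involution in $W$ obtained by extending $(i~j)$ by the defining symmetries of $W$: for every map $g$ in the group generated by the defining symmetries (none for $S_n$; $i\mapsto -i$ for $S^B_n$; $i\mapsto i+n$ for $\widetilde{S}_n$; $i\mapsto -i$ and $i\mapsto i+2n+2$ for $\widetilde{S}^C_n$), it interchanges $g(i)$ and $g(j)$, and it fixes all other points. The cost of a transposition $t$ is $\$(t)=\operatorname{tvd}(t)/2$, and for arbitrary $w\in W$, $\$(w)=\min\{\$(t_1)+\cdots+\$(t_k)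 : t_1,\dots,t_k \text{ transpositions of } W,\ t_1\cdots t_k=w\}$ (the identity has cost $0$). *)

theory Defs
  imports Complex_Main "HOL-Combinatorics.Permutations" "HOL-Algebra.Bij" "HOL-Algebra.Generated_Groups"
begin

datatype unbranched_george = Sym | SymB | AffSym | AffSymC

fun george_domain :: "unbranched_george \<Rightarrow> nat \<Rightarrow> int set" where
  "george_domain Sym n = {1..int n}"
| "george_domain SymB n = {- int n..int n} - {0}"
| "george_domain AffSym n = UNIV"
| "george_domain AffSymC n = UNIV"

text \<open>Elements of all groups are functions on \<open>int\<close>. A bijection of a finite domain is
  represented by its extension by the identity (\<open>permutes\<close>), so that the group multiplication
  is always composition of functions.\<close>

fun george_group :: "unbranched_george \<Rightarrow> nat \<Rightarrow> (int \<Rightarrow> int) set" where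
  "george_group Sym n = {w. w permutes george_domain Sym n}"
| "george_group SymB n = {w. w permutes george_domain SymB n \<and>
     (\<forall>i \<in> george_domain SymB n. w (- i) = - w i)}"
| "george_group AffSym n = {w. bij w \<and> (\<forall>i. w (i + int n) = w i + int n) \<and>
     (\<Sum>i = 1..int n. w i) = int ((n + 1) choose 2)}"
| "george_group AffSymC n = {w. bij w \<and> (\<forall>i. w (- i) = - w i) \<and>
     (\<forall>i. w (i + (2 * int n + 2)) = w i + (2 * int n + 2))}"

fun defining_symmetries :: "unbranched_george \<Rightarrow> nat \<Rightarrow> (int \<Rightarrow> int) set" where
  "defining_symmetries Sym n = {}"
| "defining_symmetries SymB n = {\<lambda>i. - i}"
| "defining_symmetries AffSym n = {\<lambda>i. i + int n}"
| "defining_symmetries AffSymC n = {\<lambda>i. - i, \<lambda>i. i + (2 * int n + 2)}"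

definition symmetry_group :: "unbranched_george \<Rightarrow> nat \<Rightarrow> (int \<Rightarrow> int) set" where
  "symmetry_group K n = generate (BijGroup UNIV) (defining_symmetries K n)"

definition transposable :: "unbranched_george \<Rightarrow> nat \<Rightarrow> int \<Rightarrow> int \<Rightarrow> bool" where
  "transposable K n i j \<longleftrightarrow> i \<in> george_domain K n \<and> j \<in> george_domain K n \<and> i \<noteq> j \<and>
     (\<exists>w \<in> george_group K n. w i = j \<and> w j = i)"

text \<open>The conditions on \<open>t\<close> below determine it uniquely from \<open>i\<close> and \<open>j\<close>: it is the
  extension of \<open>(i j)\<close> by the defining symmetries.\<close>

definition extends_swap ::
  "unbranched_george \<Rightarrow> nat \<Rightarrow> int \<Rightarrow> int \<Rightarrow> (int \<Rightarrow> int) \<Rightarrow> bool" where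
  "extends_swap K n i j t \<longleftrightarrow> t \<in> george_group K n \<and>
     (\<forall>g \<in> symmetry_group K n. t (g i) = g j \<and> t (g j) = g i) \<and>
     (\<forall>x. (\<forall>g \<in> symmetry_group K n. x \<noteq> g i \<and> x \<noteq> g j) \<longrightarrow> t x = x)"

definition transpositions :: "unbranched_george \<Rightarrow> nat \<Rightarrow> (int \<Rightarrow> int) set" where
  "transpositions K n = {t. \<exists>i j. transposable K n i j \<and> extends_swap K n i j t}"

definition tvd :: "nat \<Rightarrow> (int \<Rightarrow> int) \<Rightarrow> int" where
  "tvd n w = (\<Sum>i = 1..int n. \<bar>w i - i\<bar>)"

definition transposition_cost :: "nat \<Rightarrow> (int \<Rightarrow> int) \<Rightarrow> real" where
  "transposition_cost n t = real_of_int (tvd n t) / 2"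

text \<open>\<open>LEAST\<close> on \<open>real\<close> is the minimum of the set of values when one exists and is
  unspecified otherwise (unlike \<open>Min\<close>, it does not require the set to be finite). The empty
  list is allowed, so the identity is a product of total cost \<open>0\<close>.\<close>

definition cost :: "unbranched_george \<Rightarrow> nat \<Rightarrow> (int \<Rightarrow> int) \<Rightarrow> real" where
  "cost K n w = (LEAST c. \<exists>ts. set ts \<subseteq> transpositions K n \<and> foldr (\<circ>) ts id = w \<and>
     c = (\<Sum>t\<leftarrow>ts. transposition_cost n t))"

end

theory Submission
  imports Defs
begin

text \<open>Displacement is invariant under the defining symmetries, so \<open>tvd\<close> may be computed over any
  system of representatives, in particular over the image of the window under a group element.
  The triangle inequality then makes \<open>tvd\<close> subadditive, which is the lower bound on the cost.

  Conversely, if \<open>w\<close> is not the identity, choose \<open>i < j\<close> as close together as possible with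
  \<open>w i > i\<close> and \<open>w j < j\<close>. Everything strictly between them is fixed, hence \<open>w j \<le> i\<close> and
  \<open>j \<le> w i\<close>. A symmetry is an isometry of the integers and carries such a pair to such a pair,
  so the pairs in the orbit of \<open>(i, j)\<close> coincide or are disjoint, and they can be swapped
  simultaneously by a transposition \<open>t\<close>. At every swapped point \<open>x\<close> the point \<open>x\<close> lies between
  \<open>t x\<close> and \<open>w (t x)\<close>, so \<open>tvd (w \<circ> t) = tvd w - tvd t\<close>, and induction on \<open>tvd w\<close> gives a
  factorization of cost \<open>tvd w / 2\<close>.\<close>

section \<open>Equivariant bijections\<close>

lemma symmetry_group_subgroup:
  assumes "n \<ge> 1"
  shows "subgroup (symmetry_group K n) (BijGroup UNIV)"
proof -
  have "bij (\<lambda>i::int. i + c)" for c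
    by (rule bij_plus_right)
  moreover have "bij (\<lambda>i::int. - i)"
    by (rule bij_uminus)
  ultimately have "defining_symmetries K n \<subseteq> carrier (BijGroup UNIV)"
    by (cases K) (auto simp: BijGroup_def Bij_def)
  then show ?thesis
    unfolding symmetry_group_def by (rule group.generate_is_subgroup[OF group_BijGroup])
qed

text \<open>Over \<open>UNIV\<close> the operations of \<open>BijGroup\<close> are plain composition
  and \<open>inv_into\<close>, once the maps are known to lie in \<open>Bij UNIV\<close>. The rule
  settles this once, so later inductions deal with bare functions.\<close>

lemma symmetry_group_induct [consumes 2, case_names id gen inv comp]:
  assumes "n \<ge> 1" "g \<in> symmetry_group K n"
    and "P (\<lambda>x. x)"
    and "\<And>h. h \<in> defining_symmetries K n \<Longrightarrow> P h"
    and "\<And>h. h \<in> defining_symmetries K n \<Longrightarrow> bij h \<Longrightarrow> P (inv_into UNIV h)"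
    and comp: "\<And>g h. P g \<Longrightarrow> P h \<Longrightarrow> P (\<lambda>x. g (h x))"
  shows "P g"
proof -
  have Bij: "h \<in> Bij UNIV" if "h \<in> symmetry_group K n" for h
    using subgroup.mem_carrier[OF symmetry_group_subgroup[OF assms(1)] that]
    by (simp add: BijGroup_def)
  show ?thesis
    using assms(2) unfolding symmetry_group_def
  proof (induction rule: generate.induct)
    case one
    show ?case using assms(3) by (simp add: BijGroup_def)
  next
    case (incl h)
    then show ?case by (rule assms(4))
  next
    case (inv h)
    then have B: "h \<in> Bij UNIV"
      by (intro Bij) (auto simp: symmetry_group_def intro: generate.incl)
    then have "bij h" by (simp add: Bij_def)
    with assms(5)[OF inv] show ?case by (simp add: inv_BijGroup[OF B])
  next
    case (eng g h)
    then have "g \<in> Bij UNIV" "h \<in> Bij UNIV"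
      by (auto intro!: Bij simp: symmetry_group_def)
    then show ?case
      using comp[OF eng.IH] by (simp add: BijGroup_def compose_def restrict_UNIV)
  qed
qed

lemma symmetry_group_id: "n \<ge> 1 \<Longrightarrow> (\<lambda>x. x) \<in> symmetry_group K n"
  using subgroup.one_closed[OF symmetry_group_subgroup] by (simp add: BijGroup_def restrict_UNIV)

lemma symmetry_group_Bij: "n \<ge> 1 \<Longrightarrow> g \<in> symmetry_group K n \<Longrightarrow> g \<in> Bij UNIV"
  using subgroup.mem_carrier[OF symmetry_group_subgroup] by (simp add: BijGroup_def)

lemma symmetry_group_comp:
  assumes "n \<ge> 1" "g \<in> symmetry_group K n" "h \<in> symmetry_group K n"
  shows "(\<lambda>x. g (h x)) \<in> symmetry_group K n"
  using subgroup.m_closed[OF symmetry_group_subgroup[OF assms(1)] assms(2,3)]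
    symmetry_group_Bij[OF assms(1,2)] symmetry_group_Bij[OF assms(1,3)]
  by (simp add: BijGroup_def compose_def restrict_UNIV)

lemma symmetry_group_inv:
  assumes "n \<ge> 1" "g \<in> symmetry_group K n"
  shows "inv_into UNIV g \<in> symmetry_group K n"
  using subgroup.m_inv_closed[OF symmetry_group_subgroup[OF assms(1)] assms(2)]
    symmetry_group_Bij[OF assms]
  by (simp add: inv_BijGroup restrict_UNIV)

lemma symmetry_group_gen: "h \<in> defining_symmetries K n \<Longrightarrow> h \<in> symmetry_group K n"
  unfolding symmetry_group_def by (rule generate.incl)

lemma inv_translation: "inv_into UNIV (\<lambda>x::int. x + c) = (\<lambda>x. x - c)"
  by (rule inv_unique_comp) (auto simp: o_def)

lemma inv_uminus: "inv_into UNIV (\<lambda>x::int. - x) = (\<lambda>x. - x)"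
  by (rule inv_unique_comp) (auto simp: o_def)

lemma symmetry_group_multiple:
  assumes "n \<ge> 1" "(\<lambda>x. x + c) \<in> symmetry_group K n"
  shows "(\<lambda>x. x + k * c) \<in> symmetry_group K n"
proof (induction k rule: int_induct[where k = 0])
  case base
  show ?case using symmetry_group_id[OF assms(1)] by simp
next
  case (step1 k)
  from symmetry_group_comp[OF assms(1) step1(2) assms(2)] show ?case
    by (simp add: algebra_simps)
next
  case (step2 k)
  from symmetry_group_comp[OF assms(1) step2(2) symmetry_group_inv[OF assms]] show ?case
    by (simp add: algebra_simps inv_translation)
qed

text \<open>The groups are, in order, trivial, of order two, infinite cyclic, and infinite dihedral.
  Listing the elements turns orbit questions into congruences.\<close>

fun explicit_symmetries :: "unbranched_george \<Rightarrow> nat \<Rightarrow> (int \<Rightarrow> int) set" where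
  "explicit_symmetries Sym n = {\<lambda>x. x}"
| "explicit_symmetries SymB n = {\<lambda>x. x, \<lambda>x. - x}"
| "explicit_symmetries AffSym n = {\<lambda>x. x + k * int n | k. True}"
| "explicit_symmetries AffSymC n = {\<lambda>x. x + k * (2 * int n + 2) | k. True} \<union>
     {\<lambda>x. - x + k * (2 * int n + 2) | k. True}"

lemma symmetry_group_eq:
  assumes "n \<ge> 1"
  shows "symmetry_group K n = explicit_symmetries K n"
proof (intro equalityI subsetI)
  fix g assume "g \<in> symmetry_group K n"
  with assms show "g \<in> explicit_symmetries K n"
  proof (induction rule: symmetry_group_induct)
    case id
    show ?case by (cases K) (auto intro!: exI[of _ 0])
  next
    case (gen h)
    then show ?case
      by (cases K) (auto simp: fun_eq_iff intro: exI[of _ 0] exI[of _ 1])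
  next
    case (inv h)
    consider "h = (\<lambda>x. - x)" "K = SymB \<or> K = AffSymC" | "h = (\<lambda>x. x + int n)" "K = AffSym"
      | "h = (\<lambda>x. x + (2 * int n + 2))" "K = AffSymC"
      using inv(1) by (cases K) auto
    then show ?case
    proof cases
      case 1
      \<comment> \<open>The vanishing summand gives the shape listed for \<open>AffSymC\<close>; for
        \<open>SymB\<close> it simplifies away.\<close>
      have "inv_into UNIV h = (\<lambda>x. - x + 0 * (2 * int n + 2))"
        unfolding 1 inv_uminus by simp
      with 1(2) show ?thesis by (auto simp del: mult_zero_left) auto
    next
      case 2
      have "inv_into UNIV h = (\<lambda>x. x + (- 1) * int n)"
        unfolding 2 inv_translation by simp
      with 2(2) show ?thesis unfolding 2(2) explicit_symmetries.simps by blast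
    next
      case 3
      have "inv_into UNIV h = (\<lambda>x. x + (- 1) * (2 * int n + 2))"
        unfolding 3 inv_translation by (simp add: fun_eq_iff)
      with 3(2) show ?thesis unfolding 3(2) explicit_symmetries.simps by blast
    qed
  next
    case (comp g h)
    show ?case
    proof (cases K)
      case AffSym
      with comp obtain k l where "g = (\<lambda>x. x + k * int n)" "h = (\<lambda>x. x + l * int n)" by auto
      with AffSym show ?thesis by (auto simp: algebra_simps intro!: exI[of _ "k + l"])
    next
      case AffSymC
      define N where "N = 2 * int n + 2"
      \<comment> \<open>A sign \<open>s\<close> covers translations and reflections together, so one
        computation treats all four kinds of composite.\<close>
      have *: "explicit_symmetries K n = {\<lambda>x. s * x + k * N | s k. s = 1 \<or> s = - 1}"
        using AffSymC by (force simp: N_def[symmetric])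
      from comp obtain k l s r where
        "g = (\<lambda>x. s * x + k * N)" "h = (\<lambda>x. r * x + l * N)" "s = 1 \<or> s = -1" "r = 1 \<or> r = -1"
        unfolding * by auto
      then show ?thesis
        unfolding * by (intro CollectI exI[of _ "s * r"] exI[of _ "s * l + k"])
          (auto simp: algebra_simps)
    qed (use comp in auto)
  qed
next
  fix g assume g: "g \<in> explicit_symmetries K n"
  note facts = symmetry_group_id[OF assms] symmetry_group_multiple[OF assms]
    symmetry_group_comp[OF assms]
  show "g \<in> symmetry_group K n"
  proof (cases K)
    case Sym
    then show ?thesis using g facts(1) by auto
  next
    case SymB
    then show ?thesis using g facts(1) by (auto intro: symmetry_group_gen)
  next
    case AffSym
    then have "(\<lambda>x. x + int n) \<in> symmetry_group K n" by (intro symmetry_group_gen) auto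
    from facts(2)[OF this] show ?thesis using g AffSym by auto
  next
    case AffSymC
    then have "(\<lambda>x. x + (2 * int n + 2)) \<in> symmetry_group K n"
      by (intro symmetry_group_gen) auto
    note t = facts(2)[OF this]
    have "(\<lambda>x. - x) \<in> symmetry_group K n"
      using AffSymC by (intro symmetry_group_gen) auto
    from facts(3)[OF t this] t show ?thesis using g AffSymC by auto
  qed
qed

section \<open>Equivariant maps as a common description of the four groups\<close>

definition equivariant :: "unbranched_george \<Rightarrow> nat \<Rightarrow> (int \<Rightarrow> int) \<Rightarrow> bool" where
  "equivariant K n w \<longleftrightarrow> bij w \<and> (\<forall>x. x \<notin> george_domain K n \<longrightarrow> w x = x) \<and>
     (\<forall>g \<in> symmetry_group K n. \<forall>x. w (g x) = g (w x))"

text \<open>The symmetries that commute with \<open>w\<close> are closed under composition and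
  inverse, so generators suffice.\<close>

lemma equivariantI:
  assumes "n \<ge> 1" "bij w" "\<And>x. x \<notin> george_domain K n \<Longrightarrow> w x = x"
    and gen: "\<And>g x. g \<in> defining_symmetries K n \<Longrightarrow> w (g x) = g (w x)"
  shows "equivariant K n w"
  unfolding equivariant_def
proof (intro conjI allI impI ballI)
  fix g x assume "g \<in> symmetry_group K n"
  with assms(1) have "\<forall>x. w (g x) = g (w x)"
  proof (induction rule: symmetry_group_induct)
    case (inv h)
    show ?case
    proof
      fix x
      have "h (w (inv_into UNIV h x)) = w x"
        using gen[OF inv(1), of "inv_into UNIV h x"] inv(2) by (simp add: bij_is_surj surj_f_inv_f)
      then show "w (inv_into UNIV h x) = inv_into UNIV h (w x)"
        using inv(2) by (metis bij_inv_eq_iff)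
    qed
  qed (auto simp: gen)
  then show "w (g x) = g (w x)" ..
qed (use assms in auto)

lemma equivariant_commutes:
  "equivariant K n w \<Longrightarrow> g \<in> symmetry_group K n \<Longrightarrow> w (g x) = g (w x)"
  by (simp add: equivariant_def)

lemma sum_int_atLeastAtMost: "(\<Sum>i = 1..int n. i) = int ((n + 1) choose 2)"
proof (induction n)
  case (Suc n)
  have "{1..int (Suc n)} = insert (int (Suc n)) {1..int n}" by auto
  with Suc show ?case by (simp add: numeral_2_eq_2)
qed simp

lemma bij_fixing_outside_iff_permutes:
  "bij w \<and> (\<forall>x. x \<notin> S \<longrightarrow> w x = x) \<longleftrightarrow> w permutes S"
  by (auto simp: permutes_def bij_iff)

text \<open>Since 1 + ... + n is the prescribed binomial coefficient, the normalization of
  \<open>AffSym\<close> says that the signed displacements over the window cancel. For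
  \<open>SymB\<close>, oddness at points outside the domain comes from the extension by the
  identity.\<close>

lemma george_group_iff:
  assumes "n \<ge> 1"
  shows "w \<in> george_group K n \<longleftrightarrow>
    equivariant K n w \<and> (K = AffSym \<longrightarrow> (\<Sum>i = 1..int n. w i - i) = 0)"
    (is "_ \<longleftrightarrow> ?R")
proof
  assume w: "w \<in> george_group K n"
  have "equivariant K n w"
  proof (rule equivariantI[OF assms])
    show "bij w" using w by (cases K) (auto intro: permutes_bij)
    show "w x = x" if "x \<notin> george_domain K n" for x
      using w that by (cases K) (auto intro: permutes_not_in)
    show "w (g x) = g (w x)" if "g \<in> defining_symmetries K n" for g x
    proof (cases K)
      case SymB
      with that w have *: "g = (\<lambda>x. - x)" "w permutes george_domain K n" by auto
      show ?thesis
      proof (cases "x \<in> george_domain K n")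
        case True
        with w SymB * show ?thesis by auto
      next
        case False
        then have "- x \<notin> george_domain K n" using SymB by auto
        with False * show ?thesis by (auto simp: permutes_not_in)
      qed
    qed (use w that in auto)
  qed
  then show ?R
    using w by (auto simp: sum_subtractf sum_int_atLeastAtMost)
next
  assume R: ?R
  then have *: "bij w" "bij w \<and> (\<forall>x. x \<notin> george_domain K n \<longrightarrow> w x = x)"
    "\<And>g x. g \<in> defining_symmetries K n \<Longrightarrow> w (g x) = g (w x)"
    by (auto simp: equivariant_def symmetry_group_gen)
  from *(2) have p: "w permutes george_domain K n"
    by (simp only: bij_fixing_outside_iff_permutes)
  show "w \<in> george_group K n"
  proof (cases K)
    case Sym
    then show ?thesis using p by simp
  next
    case SymB
    then show ?thesis using p *(3)[of "\<lambda>x. - x"] by auto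
  next
    case AffSym
    with R have "(\<Sum>i = 1..int n. w i) = (\<Sum>i = 1..int n. i)" by (simp add: sum_subtractf)
    then show ?thesis
      using AffSym *(1) *(3)[of "\<lambda>x. x + int n"] by (simp add: sum_int_atLeastAtMost)
  next
    case AffSymC
    then show ?thesis
      using *(1) *(3)[of "\<lambda>x. - x"] *(3)[of "\<lambda>x. x + (2 * int n + 2)"] by simp
  qed
qed

section \<open>Window sums and total displacement\<close>

lemma window_unique:
  assumes "n \<ge> 1" "a \<in> {1..int n}" "b \<in> {1..int n}" "g \<in> symmetry_group K n" "a = g b"
  shows "a = b"
proof (cases K)
  case AffSym
  with assms obtain k where k: "a = b + k * int n" by (auto simp: symmetry_group_eq)
  then have "int n dvd a - b" by simp
  moreover have "\<bar>a - b\<bar> < int n" using assms by auto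
  ultimately have "a - b = 0" by (smt (verit) dvd_imp_le_int)
  then show ?thesis by simp
next
  case AffSymC
  define N where "N = 2 * int n + 2"
  from assms AffSymC obtain k where k: "a = b + k * N \<or> a = - b + k * N"
    by (auto simp: symmetry_group_eq N_def)
  then have "N dvd a - b \<or> N dvd a + b" by auto
  \<comment> \<open>A reflection would make \<open>N\<close> divide \<open>a + b\<close>, which lies
    between 2 and 2n while \<open>N\<close> is 2n + 2. So \<open>N\<close> divides
    \<open>a - b\<close>, whose absolute value is below \<open>N\<close>.\<close>
  moreover have "\<bar>a - b\<bar> < N" "\<bar>a + b\<bar> < N" "a + b \<noteq> 0" using assms by (auto simp: N_def)
  ultimately have "a - b = 0" by (smt (verit) dvd_imp_le_int)
  then show ?thesis by simp
qed (use assms in \<open>auto simp: symmetry_group_eq\<close>)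

text \<open>In the type C affine case the multiples of \<open>n + 1\<close> lie in the domain but in no translate or
  reflection of the window. Each is the centre of a reflection in the symmetry group, so, like the
  points outside the domain, it is fixed by every equivariant map.\<close>

definition pinned :: "unbranched_george \<Rightarrow> nat \<Rightarrow> int set" where
  "pinned K n = - george_domain K n \<union> (if K = AffSymC then {x. int n + 1 dvd x} else {})"

lemma equivariant_pinned:
  assumes "n \<ge> 1" and v: "equivariant K n v" and x: "x \<in> pinned K n"
  shows "v x = x"
proof (cases "x \<in> george_domain K n")
  case False
  then show ?thesis using v by (simp add: equivariant_def)
next
  case True
  with x have K: "K = AffSymC" and "int n + 1 dvd x"
    by (auto simp: pinned_def split: if_splits)
  then obtain k where k: "x = (int n + 1) * k" by blast
  have "(\<lambda>y. - y + k * (2 * int n + 2)) \<in> symmetry_group K n"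
    using K by (auto simp: symmetry_group_eq[OF assms(1)])
  then have "v (- x + k * (2 * int n + 2)) = - v x + k * (2 * int n + 2)"
    using v by (auto simp: equivariant_def)
  moreover have "- x + k * (2 * int n + 2) = x" by (simp add: k algebra_simps)
  ultimately show ?thesis by simp
qed

lemma window_cover:
  assumes "n \<ge> 1" and x: "x \<notin> pinned K n"
  shows "\<exists>r \<in> {1..int n}. \<exists>g \<in> symmetry_group K n. x = g r"
proof (cases K)
  case Sym
  with x show ?thesis by (auto simp: pinned_def symmetry_group_eq[OF assms(1)])
next
  case SymB
  then have "\<bar>x\<bar> \<in> {1..int n}" "x = \<bar>x\<bar> \<or> x = - \<bar>x\<bar>"
    using x by (auto simp: pinned_def)
  then show ?thesis
    using SymB by (auto simp: symmetry_group_eq[OF assms(1)])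
next
  case AffSym
  \<comment> \<open>The shift by 1 makes the residues run over 1, ..., n instead of 0, ..., n -
    1.\<close>
  define r where "r = (x - 1) mod int n + 1"
  have "r \<in> {1..int n}" using assms(1) by (auto simp: r_def int_one_le_iff_zero_less add1_zle_eq)
  moreover have "x = r + ((x - 1) div int n) * int n"
    by (simp add: r_def)
  ultimately show ?thesis
    using AffSym unfolding symmetry_group_eq[OF assms(1)]
    by (intro bexI[of _ r] bexI[of _ "\<lambda>y. y + ((x - 1) div int n) * int n"]) auto
next
  case AffSymC
  define N where "N = 2 * int n + 2"
  define m where "m = x mod N"
  define k where "k = x div N"
  have xm: "x = m + k * N" by (simp add: m_def k_def)
  have m: "0 \<le> m" "m < N" by (auto simp: m_def N_def)
  have dvd: "(int n + 1) dvd N" by (auto simp: N_def intro: dvdI[of _ _ 2])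
  have "\<not> (int n + 1) dvd x" using x AffSymC by (auto simp: pinned_def)
  then have "\<not> (int n + 1) dvd m"
    using dvd by (auto simp: xm)
  then have "m \<noteq> 0" "m \<noteq> int n + 1" by auto
  \<comment> \<open>The residues 0 and n + 1 are pinned. Those above n + 1 are reflected into the
    window: \<open>x\<close> is \<open>- (N - m) + (k + 1) * N\<close>.\<close>
  then consider "m \<in> {1..int n}" | "N - m \<in> {1..int n}" using m by (force simp: N_def)
  then show ?thesis
  proof cases
    case 1
    then show ?thesis using xm AffSymC
      by (intro bexI[of _ m] bexI[of _ "\<lambda>x. x + k * N"])
        (auto simp: symmetry_group_eq[OF assms(1)] N_def)
  next
    case 2
    then show ?thesis using xm AffSymC
      by (intro bexI[of _ "N - m"] bexI[of _ "\<lambda>x. - x + (k + 1) * N"])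
        (auto simp: symmetry_group_eq[OF assms(1)] N_def[symmetric], auto simp: algebra_simps)
  qed
qed

lemma window_not_pinned: "i \<in> {1..int n} \<Longrightarrow> i \<notin> pinned K n"
  by (cases K) (auto simp: pinned_def dest: zdvd_imp_le)

lemma equivariant_not_pinned:
  assumes "n \<ge> 1" "equivariant K n v" "x \<notin> pinned K n"
  shows "v x \<notin> pinned K n"
proof
  assume "v x \<in> pinned K n"
  moreover from this have "v (v x) = v x" by (rule equivariant_pinned[OF assms(1,2)])
  then have "v x = x" using assms(2) by (auto simp: equivariant_def bij_def dest: injD)
  ultimately show False using assms(3) by simp
qed

text \<open>\<open>v\<close> carries the window to another system of orbit representatives, and
  \<open>f\<close> is constant on orbits. Sending \<open>i\<close> to the representative
  \<open>r i\<close> of \<open>v i\<close> permutes the window.\<close>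

lemma sum_window_equivariant:
  fixes f :: "int \<Rightarrow> int"
  assumes "n \<ge> 1" and v: "equivariant K n v"
    and f: "\<And>g x. g \<in> symmetry_group K n \<Longrightarrow> f (g x) = f x"
  shows "(\<Sum>i = 1..int n. f (v i)) = (\<Sum>i = 1..int n. f i)"
proof -
  have "\<forall>i \<in> {1..int n}. \<exists>p. fst p \<in> {1..int n} \<and> snd p \<in> symmetry_group K n \<and> v i = snd p (fst p)"
  proof
    fix i assume "i \<in> {1..int n}"
    then have "v i \<notin> pinned K n"
      by (intro equivariant_not_pinned[OF assms(1,2)] window_not_pinned)
    then obtain r g where "r \<in> {1..int n}" "g \<in> symmetry_group K n" "v i = g r"
      using window_cover[OF assms(1)] by blast
    then show "\<exists>p. fst p \<in> {1..int n} \<and> snd p \<in> symmetry_group K n \<and> v i = snd p (fst p)"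
      by (intro exI[of _ "(r, g)"]) simp
  qed
  then obtain p where p: "\<forall>i \<in> {1..int n}.
      fst (p i) \<in> {1..int n} \<and> snd (p i) \<in> symmetry_group K n \<and> v i = snd (p i) (fst (p i))"
    by (rule bchoice[THEN exE])
  define r where "r = fst \<circ> p"
  define g where "g = snd \<circ> p"
  have rg: "r i \<in> {1..int n} \<and> g i \<in> symmetry_group K n \<and> v i = g i (r i)"
    if "i \<in> {1..int n}" for i
    using bspec[OF p that] by (simp add: r_def g_def)
  have "inj_on r {1..int n}"
  proof (rule inj_onI)
    fix a b assume ab: "a \<in> {1..int n}" "b \<in> {1..int n}" "r a = r b"
    \<comment> \<open>\<open>h\<close> carries \<open>v b\<close> to \<open>v a\<close>, as both
      have the same representative. Commuting \<open>h\<close> past \<open>v\<close> and cancelling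
      \<open>v\<close> puts \<open>a\<close> and \<open>b\<close> in one orbit.\<close>
    define h where "h = (\<lambda>x. g a (inv_into UNIV (g b) x))"
    have gb: "g b \<in> symmetry_group K n" "g a \<in> symmetry_group K n" using rg ab by auto
    then have h: "h \<in> symmetry_group K n"
      unfolding h_def
      by (intro symmetry_group_comp[OF assms(1) gb(2) symmetry_group_inv[OF assms(1) gb(1)]])
    have "inj (g b)"
      using symmetry_group_Bij[OF assms(1) gb(1)] by (simp add: Bij_def bij_def)
    then have "v a = h (v b)"
      using rg[OF ab(1)] rg[OF ab(2)] ab(3) by (simp add: h_def)
    also have "\<dots> = v (h b)" using v h by (simp add: equivariant_def)
    finally have "a = h b" using v by (auto simp: equivariant_def bij_def dest: injD)
    with window_unique[OF assms(1) ab(1,2) h] show "a = b" .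
  qed
  moreover have "r ` {1..int n} \<subseteq> {1..int n}" using rg by auto
  ultimately have "bij_betw r {1..int n} {1..int n}"
    by (simp add: bij_betw_def endo_inj_surj)
  then have "(\<Sum>i = 1..int n. f (r i)) = (\<Sum>i = 1..int n. f i)"
    by (rule sum.reindex_bij_betw)
  moreover have "(\<Sum>i = 1..int n. f (v i)) = (\<Sum>i = 1..int n. f (r i))"
    using rg f by (intro sum.cong) auto
  ultimately show ?thesis by simp
qed

section \<open>Displacement under symmetries and products\<close>

lemma symmetry_group_isometry:
  assumes "n \<ge> 1" "g \<in> symmetry_group K n"
  obtains c where "\<And>x. g x = x + c" | c where "\<And>x. g x = c - x"
proof -
  have "(\<exists>c. \<forall>x. g x = x + c) \<or> (\<exists>c. \<forall>x. g x = c - x)"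
  proof (cases K)
    case Sym
    then have "\<forall>x. g x = x + 0" using assms by (auto simp: symmetry_group_eq)
    then show ?thesis by blast
  next
    case SymB
    then have "(\<forall>x. g x = x + 0) \<or> (\<forall>x. g x = 0 - x)"
      using assms by (auto simp: symmetry_group_eq)
    then show ?thesis by blast
  next
    case AffSym
    then show ?thesis using assms by (auto simp: symmetry_group_eq)
  next
    case AffSymC
    then obtain k where "(\<forall>x. g x = x + k * (2 * int n + 2)) \<or> (\<forall>x. g x = k * (2 * int n + 2) - x)"
      using assms by (auto simp: symmetry_group_eq)
    then show ?thesis by blast
  qed
  with that show ?thesis by blast
qed

lemma sum_displacement_equivariant:
  assumes "n \<ge> 1" "equivariant K n v" "equivariant K n u"
  shows "(\<Sum>i = 1..int n. \<bar>u (v i) - v i\<bar>) = tvd n u"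
  unfolding tvd_def
proof (rule sum_window_equivariant[OF assms(1,2)])
  fix g x assume g: "g \<in> symmetry_group K n"
  then have "u (g x) = g (u x)" using assms(3) by (simp add: equivariant_def)
  then show "\<bar>u (g x) - g x\<bar> = \<bar>u x - x\<bar>"
    using assms(1) g by (elim symmetry_group_isometry) auto
qed

lemma tvd_comp_le:
  assumes "n \<ge> 1" "equivariant K n u" "equivariant K n v"
  shows "tvd n (u \<circ> v) \<le> tvd n u + tvd n v"
proof -
  have "tvd n (u \<circ> v) \<le> (\<Sum>i = 1..int n. \<bar>u (v i) - v i\<bar> + \<bar>v i - i\<bar>)"
    unfolding tvd_def by (intro sum_mono) auto
  also have "\<dots> = tvd n u + tvd n v"
    using sum_displacement_equivariant[OF assms(1,3,2)] by (simp add: sum.distrib tvd_def)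
  finally show ?thesis .
qed

lemma equivariant_id: "equivariant K n id"
  by (simp add: equivariant_def)

lemma equivariant_comp: "equivariant K n u \<Longrightarrow> equivariant K n v \<Longrightarrow> equivariant K n (u \<circ> v)"
  by (auto simp: equivariant_def intro: bij_comp)

text \<open>For \<open>AffSym\<close> the symmetries are translations, so even the signed
  displacement is invariant. Reindexing along \<open>v\<close> then makes the displacement sums of
  \<open>u\<close> and \<open>v\<close> add up.\<close>

lemma george_group_comp:
  assumes "n \<ge> 1" "u \<in> george_group K n" "v \<in> george_group K n"
  shows "u \<circ> v \<in> george_group K n"
  unfolding george_group_iff[OF assms(1)]
proof (intro conjI impI)
  have eq: "equivariant K n u" "equivariant K n v"
    using assms by (auto simp: george_group_iff)
  then show "equivariant K n (u \<circ> v)" by (rule equivariant_comp)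
  assume K: "K = AffSym"
  have "(\<Sum>i = 1..int n. u (v i) - v i) = (\<Sum>i = 1..int n. u i - i)"
  proof (rule sum_window_equivariant[OF assms(1) eq(2)])
    fix g x assume "g \<in> symmetry_group K n"
    then show "u (g x) - g x = u x - x"
      using eq(1) K by (auto simp: equivariant_def symmetry_group_eq[OF assms(1)])
  qed
  moreover have "(\<Sum>i = 1..int n. u i - i) = 0" "(\<Sum>i = 1..int n. v i - i) = 0"
    using assms K by (auto simp: george_group_iff simp del: george_group.simps)
  ultimately show "(\<Sum>i = 1..int n. (u \<circ> v) i - i) = 0"
    by (simp add: sum_subtractf)
qed

text \<open>Equivariance spreads fixedness from the window to all its images; every other point is
  pinned.\<close>

lemma tvd_eq_0_imp_id:
  assumes "n \<ge> 1" "equivariant K n w" "tvd n w = 0"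
  shows "w = id"
proof
  fix x
  have fixed: "w i = i" if "i \<in> {1..int n}" for i
    using assms(3) that by (simp add: tvd_def sum_nonneg_eq_0_iff)
  show "w x = id x"
  proof (rule ccontr)
    assume "w x \<noteq> id x"
    then have "x \<notin> pinned K n" using equivariant_pinned[OF assms(1,2)] by auto
    then obtain r g where rg: "r \<in> {1..int n}" "g \<in> symmetry_group K n" "x = g r"
      using window_cover[OF assms(1)] by metis
    then have "w x = x" using fixed assms(2) by (simp add: equivariant_def)
    with \<open>w x \<noteq> id x\<close> show False by simp
  qed
qed

section \<open>Adjacent crossings\<close>

text \<open>Fixed points in between take the place of minimality of \<open>j - i\<close>: this local
  condition passes to images under symmetries and still determines the partner of each
  endpoint.\<close>

definition crossing :: "(int \<Rightarrow> int) \<Rightarrow> int \<Rightarrow> int \<Rightarrow> bool" where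
  "crossing w i j \<longleftrightarrow> i < j \<and> i < w i \<and> w j < j \<and> (\<forall>k. i < k \<and> k < j \<longrightarrow> w k = k)"

text \<open>By injectivity the image of a moved point is moved, so \<open>w i\<close> and
  \<open>w j\<close> cannot land strictly between \<open>i\<close> and \<open>j\<close>, where all
  points are fixed.\<close>

lemma crossing_jump:
  assumes "inj w" "crossing w i j"
  shows "j \<le> w i" "w j \<le> i"
proof -
  have "w (w i) \<noteq> w i" "w (w j) \<noteq> w j"
    using assms by (auto simp: crossing_def dest: injD)
  then show "j \<le> w i" "w j \<le> i"
    using assms(2) unfolding crossing_def by (meson not_le)+
qed

text \<open>Translations keep the order and the directions of motion; reflections reverse both,
  which exchanges the endpoints.\<close>

lemma crossing_symmetry:
  assumes "n \<ge> 1" "equivariant K n w" "g \<in> symmetry_group K n" "crossing w i j"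
  shows "crossing w (g i) (g j) \<or> crossing w (g j) (g i)"
proof -
  have comm: "w (g x) = g (w x)" for x using assms(2,3) by (simp add: equivariant_def)
  from assms(1,3) show ?thesis
  proof (cases rule: symmetry_group_isometry)
    case (1 c)
    have "w k = k" if "i + c < k" "k < j + c" for k
      using comm[of "k - c"] assms(4) that by (simp add: 1 crossing_def)
    then have "crossing w (g i) (g j)"
      using comm[of i] comm[of j] assms(4) by (simp add: 1 crossing_def)
    then show ?thesis ..
  next
    case (2 c)
    have "w k = k" if "c - j < k" "k < c - i" for k
      using comm[of "c - k"] assms(4) that by (simp add: 2 crossing_def)
    then have "crossing w (g j) (g i)"
      using comm[of i] comm[of j] assms(4) by (simp add: 2 crossing_def)
    then show ?thesis ..
  qed
qed

lemma crossing_right_unique: "crossing w x y \<Longrightarrow> crossing w x z \<Longrightarrow> y = z"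
  unfolding crossing_def by (metis less_irrefl linorder_neqE)

lemma crossing_left_unique: "crossing w x z \<Longrightarrow> crossing w y z \<Longrightarrow> x = y"
  unfolding crossing_def by (metis less_irrefl linorder_neqE)

definition neighbours :: "(int \<Rightarrow> int) \<Rightarrow> int \<Rightarrow> int \<Rightarrow> bool" where
  "neighbours w x y \<longleftrightarrow> crossing w x y \<or> crossing w y x"

text \<open>The direction in which \<open>w\<close> moves \<open>x\<close> decides whether
  \<open>x\<close> is a left or a right endpoint. On each side a nearer partner would be a moved
  point inside the gap of a farther one.\<close>

lemma neighbours_unique: "neighbours w x y \<Longrightarrow> neighbours w x z \<Longrightarrow> y = z"
  unfolding neighbours_def
  by (metis crossing_left_unique crossing_right_unique crossing_def less_asym)

text \<open>By \<open>crossing_jump\<close>, \<open>x\<close> lies on the segment from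
  \<open>y\<close> to \<open>w y\<close>.\<close>

lemma neighbours_shortcut:
  assumes "inj w" "neighbours w x y"
  shows "\<bar>w y - x\<bar> = \<bar>w y - y\<bar> - \<bar>y - x\<bar>"
  using assms(2) crossing_jump[OF assms(1), of x y] crossing_jump[OF assms(1), of y x]
  unfolding neighbours_def crossing_def by auto

lemma ex_crossing:
  assumes "a < b" "a < w a" "w b < b"
  shows "\<exists>i j. crossing w i j"
proof -
  let ?P = "\<lambda>p. fst p < snd p \<and> fst p < w (fst p) \<and> w (snd p) < snd p"
  have "?P (a, b)" using assms by simp
  from ex_has_least_nat[of ?P, OF this, of "\<lambda>p. nat (snd p - fst p)"]
  obtain i j where ij: "?P (i, j)"
    and least: "\<And>k l. ?P (k, l) \<Longrightarrow> nat (j - i) \<le> nat (l - k)" by force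
  \<comment> \<open>A moved \<open>k\<close> would give a shorter pair: \<open>(k, j)\<close> if it
    moves up, \<open>(i, k)\<close> if it moves down.\<close>
  have "w k = k" if "i < k" "k < j" for k
    using ij that least[of k j] least[of i k] by (cases "w k" k rule: linorder_cases) auto
  with ij show ?thesis unfolding crossing_def by auto
qed

lemma crossing_exists:
  assumes "n \<ge> 1" "w \<in> george_group K n" "w \<noteq> id"
  shows "\<exists>i j. crossing w i j"
proof -
  have eq: "equivariant K n w" using assms by (simp add: george_group_iff)
  obtain x where x: "w x \<noteq> x" using assms(3) by (auto simp: fun_eq_iff)
  \<comment> \<open>\<open>w\<close> maps moved points to moved points, so the least one moves up
    and the greatest one moves down.\<close>
  have finite: "\<exists>i j. crossing w i j" if "finite (george_domain K n)"
  proof -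
    define M where "M = {x. w x \<noteq> x}"
    have "M \<subseteq> george_domain K n" using eq by (auto simp: M_def equivariant_def)
    then have fin: "finite M" using that by (rule finite_subset)
    have "M \<noteq> {}" using x by (auto simp: M_def)
    then have mem: "Min M \<in> M" "Max M \<in> M" using fin by auto
    have "w y \<in> M" if "y \<in> M" for y
      using that eq by (auto simp: M_def equivariant_def bij_def dest: injD)
    then have "Min M \<le> w (Min M)" "w (Min M) \<le> Max M" "w (Max M) \<le> Max M"
      using mem fin by auto
    then have "Min M < w (Min M)" "w (Max M) < Max M" "Min M < Max M"
      using mem by (auto simp: M_def)
    then show ?thesis by (intro ex_crossing)
  qed
  show ?thesis
  proof (cases K)
    case AffSym
    have nz: "\<not> (\<forall>i \<in> {1..int n}. w i - i = 0)"
    proof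
      assume "\<forall>i \<in> {1..int n}. w i - i = 0"
      then have "tvd n w = 0" by (simp add: tvd_def)
      with tvd_eq_0_imp_id[OF assms(1) eq] assms(3) show False by simp
    qed
    have sum: "(\<Sum>i = 1..int n. w i - i) = 0"
      using AffSym assms by (simp add: george_group_iff del: george_group.simps)
    then have sum': "(\<Sum>i = 1..int n. - (w i - i)) = 0" unfolding sum_negf by simp
    have zero: "\<forall>i \<in> {1..int n}. f i = 0"
      if "(\<Sum>i = 1..int n. f i) = 0" "\<forall>i \<in> {1..int n}. 0 \<le> f i" for f :: "int \<Rightarrow> int"
      using that by (subst (asm) sum_nonneg_eq_0_iff) auto
    from nz have nz': "\<not> (\<forall>i \<in> {1..int n}. - (w i - i) = 0)"
      unfolding neg_equal_0_iff_equal .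
    \<comment> \<open>Displacements that sum to zero without all vanishing take both signs.\<close>
    have "\<not> (\<forall>i \<in> {1..int n}. 0 \<le> w i - i)" using zero[OF sum] nz by blast
    moreover have "\<not> (\<forall>i \<in> {1..int n}. 0 \<le> - (w i - i))" using zero[OF sum'] nz' by blast
    ultimately obtain a b where ab: "a \<in> {1..int n}" "w a > a" "b \<in> {1..int n}" "w b < b" by force
    \<comment> \<open>One period moves \<open>b\<close> to the right of the whole window, hence of
      \<open>a\<close>.\<close>
    have "(\<lambda>x. x + int n) \<in> symmetry_group K n"
      using AffSym by (intro symmetry_group_gen) simp
    then have "w (b + int n) = w b + int n" using eq by (auto simp: equivariant_def)
    then show ?thesis using ab by (intro ex_crossing[of a "b + int n"]) auto
  next
    case AffSymC
    have "(\<lambda>x. - x) \<in> symmetry_group K n"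
      using AffSymC by (intro symmetry_group_gen) simp
    then have neg: "w (- y) = - w y" for y using eq by (auto simp: equivariant_def)
    obtain a where a: "w a > a"
      using x neg[of x] by (cases "w x > x") (auto intro: that[of x] that[of "- x"])
    \<comment> \<open>Reflection turns the rise at \<open>a\<close> into a fall at
      \<open>- a\<close>. This many periods bring the fall to the right of \<open>a\<close>, because
      each period is at least 2.\<close>
    define k where "k = \<bar>a\<bar> + 1"
    have "(\<lambda>x. x + k * (2 * int n + 2)) \<in> symmetry_group K n"
      using AffSymC by (auto simp: symmetry_group_eq[OF assms(1)])
    from equivariant_commutes[OF eq this, of "- a"]
    have shift: "w (- a + k * (2 * int n + 2)) = w (- a) + k * (2 * int n + 2)" .
    have "k * 2 \<le> k * (2 * int n + 2)" by (intro mult_left_mono) (auto simp: k_def)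
    moreover have "a < k" by (simp add: k_def)
    ultimately have "a < - a + k * (2 * int n + 2)" by (smt (verit))
    moreover have "w (- a + k * (2 * int n + 2)) < - a + k * (2 * int n + 2)"
      unfolding shift neg using a by simp
    ultimately show ?thesis using a by (intro ex_crossing)
  qed (use finite in auto)
qed

section \<open>Orbit swaps\<close>

definition orbit_pair :: "(int \<Rightarrow> int) set \<Rightarrow> int \<Rightarrow> int \<Rightarrow> int \<Rightarrow> int \<Rightarrow> bool" where
  "orbit_pair G i j x y \<longleftrightarrow> (\<exists>g \<in> G. x = g i \<and> y = g j \<or> x = g j \<and> y = g i)"

text \<open>\<open>THE\<close> is justified only when partners are unique; for crossings this comes
  from \<open>neighbours_unique\<close> in \<open>swap_pair\<close>.\<close>

definition orbit_swap :: "(int \<Rightarrow> int) set \<Rightarrow> int \<Rightarrow> int \<Rightarrow> int \<Rightarrow> int" where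
  "orbit_swap G i j x =
     (if \<exists>y. orbit_pair G i j x y then THE y. orbit_pair G i j x y else x)"

locale george_crossing =
  fixes K :: unbranched_george and n :: nat and w :: "int \<Rightarrow> int" and i j :: int
  assumes window: "n \<ge> 1"
    and equivariant: "equivariant K n w"
    and crossing: "crossing w i j"
begin

abbreviation pair where "pair \<equiv> orbit_pair (symmetry_group K n) i j"
abbreviation t where "t \<equiv> orbit_swap (symmetry_group K n) i j"

lemma inj: "inj w"
  using equivariant by (simp add: equivariant_def bij_def)

lemma pair_sym: "pair x y \<Longrightarrow> pair y x"
  by (auto simp: orbit_pair_def)

lemma pair_neighbours: "pair x y \<Longrightarrow> neighbours w x y"
  unfolding orbit_pair_def neighbours_def
  using crossing_symmetry[OF window equivariant _ crossing] by blast

lemma swap_pair: "pair x y \<Longrightarrow> t x = y"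
  unfolding orbit_swap_def
  by (auto intro!: the_equality dest: neighbours_unique[OF pair_neighbours pair_neighbours])

lemma swap_fixed: "\<nexists>y. pair x y \<Longrightarrow> t x = x"
  by (simp add: orbit_swap_def)

lemma swap_cases: "pair x (t x) \<or> t x = x"
  using swap_pair swap_fixed by metis

lemma swap_swap: "t (t x) = x"
  using swap_cases[of x] swap_pair[OF pair_sym] by metis

lemma pair_symmetry:
  assumes "g \<in> symmetry_group K n" "pair x y"
  shows "pair (g x) (g y)"
proof -
  from assms(2) obtain h where h: "h \<in> symmetry_group K n"
    "x = h i \<and> y = h j \<or> x = h j \<and> y = h i" by (auto simp: orbit_pair_def)
  show ?thesis
    unfolding orbit_pair_def using symmetry_group_comp[OF window assms(1) h(1)] h(2)
    by (intro bexI[of _ "\<lambda>x. g (h x)"]) auto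
qed

lemma swap_symmetry:
  assumes "g \<in> symmetry_group K n"
  shows "t (g x) = g (t x)"
proof (cases "\<exists>y. pair x y")
  case True
  then show ?thesis using pair_symmetry[OF assms] swap_pair by metis
next
  case False
  have "\<nexists>y. pair (g x) y"
  proof
    assume "\<exists>y. pair (g x) y"
    then obtain y where "pair (g x) y" ..
    from pair_symmetry[OF symmetry_group_inv[OF window assms] this]
    have "\<exists>y. pair (inv_into UNIV g (g x)) y" ..
    moreover have "inj g"
      using symmetry_group_Bij[OF window assms] by (simp add: Bij_def bij_def)
    ultimately show False using False by simp
  qed
  with False show ?thesis by (simp add: swap_fixed)
qed

lemma swap_equivariant: "equivariant K n t"
  unfolding equivariant_def
proof (intro conjI allI impI ballI)
  show "bij t" by (rule bijI') (metis swap_swap, metis swap_swap)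
  show "t x = x" if "x \<notin> george_domain K n" for x
  proof -
    \<comment> \<open>Both members of a pair are moved by \<open>w\<close>, so a point outside the
      domain belongs to no pair.\<close>
    have "w x = x" using equivariant that by (simp add: equivariant_def)
    then show ?thesis
      using swap_cases[of x] pair_neighbours[of x "t x"] by (auto simp: neighbours_def crossing_def)
  qed
qed (rule swap_symmetry)

text \<open>For \<open>AffSym\<close>, reindexing the signed displacement sum of the involution
  \<open>t\<close> along \<open>t\<close> itself negates it, so it is zero.\<close>

lemma swap_george_group: "t \<in> george_group K n"
  unfolding george_group_iff[OF window]
proof (intro conjI impI)
  show "equivariant K n t" by (rule swap_equivariant)
  assume K: "K = AffSym"
  have "(\<Sum>x = 1..int n. t (t x) - t x) = (\<Sum>x = 1..int n. t x - x)"
  proof (rule sum_window_equivariant[OF window swap_equivariant])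
    fix g x assume "g \<in> symmetry_group K n"
    then show "t (g x) - g x = t x - x"
      using K swap_symmetry[of g x] by (auto simp: symmetry_group_eq[OF window])
  qed
  then show "(\<Sum>x = 1..int n. t x - x) = 0"
    by (simp add: swap_swap sum_subtractf)
qed

lemma swap_endpoints: "g \<in> symmetry_group K n \<Longrightarrow> t (g i) = g j \<and> t (g j) = g i"
  by (auto intro!: swap_pair simp: orbit_pair_def)

lemma swap_transposition: "t \<in> transpositions K n"
proof -
  have "extends_swap K n i j t"
    unfolding extends_swap_def
    using swap_george_group swap_endpoints by (auto intro!: swap_fixed simp: orbit_pair_def)
  moreover have "t i = j" "t j = i"
    using swap_endpoints[OF symmetry_group_id[OF window]] by auto
  moreover have "i \<in> george_domain K n" "j \<in> george_domain K n" "i \<noteq> j"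
    using equivariant crossing by (auto simp: equivariant_def crossing_def)
  ultimately show ?thesis
    unfolding transpositions_def transposable_def using swap_george_group by blast
qed

lemma tvd_swap_pos: "tvd n t > 0"
proof -
  have "t i \<noteq> i"
    using swap_endpoints[OF symmetry_group_id[OF window]] crossing by (auto simp: crossing_def)
  then have "tvd n t \<noteq> 0"
    using tvd_eq_0_imp_id[OF window swap_equivariant] by auto
  moreover have "tvd n t \<ge> 0" by (simp add: tvd_def sum_nonneg)
  ultimately show ?thesis by simp
qed

lemma tvd_comp_swap: "tvd n (w \<circ> t) = tvd n w - tvd n t"
proof -
  have "\<bar>w (t x) - x\<bar> = \<bar>w (t x) - t x\<bar> - \<bar>t x - x\<bar>" for x
    using swap_cases[of x] neighbours_shortcut[OF inj pair_neighbours] by auto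
  then have "tvd n (w \<circ> t) = (\<Sum>x = 1..int n. \<bar>w (t x) - t x\<bar>) - tvd n t"
    by (simp add: tvd_def sum_subtractf)
  \<comment> \<open>Reindexing along \<open>t\<close> turns the remaining sum into
    \<open>tvd n w\<close>.\<close>
  then show ?thesis
    by (simp add: sum_displacement_equivariant[OF window swap_equivariant equivariant])
qed

end

section \<open>Cost\<close>

lemma foldr_comp_Cons: "foldr (\<circ>) (a # ts) f = a \<circ> foldr (\<circ>) ts f"
  by simp

lemma foldr_comp_id: "foldr (\<circ>) ts f = foldr (\<circ>) ts id \<circ> f"
proof (induction ts)
  case (Cons a ts)
  have "foldr (\<circ>) (a # ts) f = a \<circ> foldr (\<circ>) ts f" by (rule foldr_comp_Cons)
  also have "\<dots> = a \<circ> (foldr (\<circ>) ts id \<circ> f)" by (subst Cons.IH) (rule refl)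
  finally show ?case unfolding foldr_comp_Cons o_assoc .
qed simp

lemma factorization_exists:
  assumes "n \<ge> 1" "w \<in> george_group K n"
  shows "\<exists>ts. set ts \<subseteq> transpositions K n \<and> foldr (\<circ>) ts id = w \<and>
    (\<Sum>t\<leftarrow>ts. transposition_cost n t) = real_of_int (tvd n w) / 2"
  using assms(2)
proof (induction "nat (tvd n w)" arbitrary: w rule: less_induct)
  case less
  show ?case
  proof (cases "w = id")
    case True
    then show ?thesis by (intro exI[of _ "[]"]) (simp add: tvd_def)
  next
    case False
    then obtain i j where "crossing w i j"
      using crossing_exists[OF assms(1) less.prems] by blast
    then interpret george_crossing K n w i j
      using assms(1) less.prems by unfold_locales (auto simp: george_group_iff)
    have "0 \<le> tvd n (w \<circ> t)" by (simp add: tvd_def sum_nonneg)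
    then have "nat (tvd n (w \<circ> t)) < nat (tvd n w)"
      using tvd_comp_swap tvd_swap_pos by linarith
    from less.hyps[OF this george_group_comp[OF assms(1) less.prems swap_george_group]]
    obtain ts where ts: "set ts \<subseteq> transpositions K n" "foldr (\<circ>) ts id = w \<circ> t"
      "(\<Sum>t\<leftarrow>ts. transposition_cost n t) = real_of_int (tvd n (w \<circ> t)) / 2" by blast
    \<comment> \<open>\<open>t\<close> is an involution, so multiplying \<open>w \<circ> t\<close>
      by it on the right restores \<open>w\<close>.\<close>
    have "foldr (\<circ>) (ts @ [t]) id = w"
      using foldr_comp_id[of ts t] ts(2) by (simp add: fun_eq_iff swap_swap)
    moreover have "(\<Sum>t\<leftarrow>ts @ [t]. transposition_cost n t) = real_of_int (tvd n w) / 2"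
      by (simp add: ts(3) tvd_comp_swap transposition_cost_def[of n t] field_simps)
    moreover have "set (ts @ [t]) \<subseteq> transpositions K n"
      using ts(1) swap_transposition by simp
    ultimately show ?thesis by blast
  qed
qed

text \<open>Equivariance is carried through the induction because \<open>tvd_comp_le\<close>
  requires it of the product of the tail.\<close>

lemma factorization_lower_bound:
  assumes "n \<ge> 1" "set ts \<subseteq> transpositions K n"
  shows "equivariant K n (foldr (\<circ>) ts id) \<and>
    real_of_int (tvd n (foldr (\<circ>) ts id)) / 2 \<le> (\<Sum>t\<leftarrow>ts. transposition_cost n t)"
  using assms(2)
proof (induction ts)
  case Nil
  then show ?case by (simp add: equivariant_id[unfolded id_def] tvd_def)
next
  case (Cons t ts)
  have t: "equivariant K n t"
    using Cons.prems assms(1) by (auto simp: transpositions_def extends_swap_def george_group_iff)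
  have "set ts \<subseteq> transpositions K n" using Cons.prems by simp
  note IH = Cons.IH[OF this]
  from tvd_comp_le[OF assms(1) t conjunct1[OF IH]] conjunct2[OF IH]
  have "real_of_int (tvd n (t \<circ> foldr (\<circ>) ts id)) / 2 \<le> (\<Sum>t\<leftarrow>t # ts. transposition_cost n t)"
    unfolding list.map sum_list.Cons transposition_cost_def[of n t] by linarith
  then show ?case
    unfolding foldr_comp_Cons using equivariant_comp[OF t conjunct1[OF IH]] by blast
qed

theorem theorem3p1:
  fixes K :: unbranched_george and n :: nat and w :: "int \<Rightarrow> int"
  assumes "n \<ge> 1" and "w \<in> george_group K n"
  shows "cost K n w = real_of_int (tvd n w) / 2"
  unfolding cost_def
proof (rule Least_equality)
  show "\<exists>ts. set ts \<subseteq> transpositions K n \<and> foldr (\<circ>) ts id = w \<and>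
      real_of_int (tvd n w) / 2 = (\<Sum>t\<leftarrow>ts. transposition_cost n t)"
    using factorization_exists[OF assms] by metis
next
  fix c
  assume "\<exists>ts. set ts \<subseteq> transpositions K n \<and> foldr (\<circ>) ts id = w \<and>
      c = (\<Sum>t\<leftarrow>ts. transposition_cost n t)"
  then show "real_of_int (tvd n w) / 2 \<le> c"
    using factorization_lower_bound[OF assms(1)] by blast
qed

end
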